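(* Let $$f(\alpha)=\frac{\eta(\alpha)}{\left(\Phi^{-1}(\alpha)\right)^2},\qquad \eta(\alpha)=\frac{1-2\alpha}{2}\ln\frac{1-\alpha}{\alpha},\qquad \alpha\in(0,\tfrac12).$$ Then $$f(\alpha)=\frac14-\frac{\ln(-\ln\alpha)}{8\ln\alpha}+o\left(\frac{\ln(-\ln\alpha)}{\ln\alpha}\right)$$ as $\alpha\to0$ (from the right).
   Context: $\Phi$ is the distribution function of the standard normal distribution and $\Phi^{-1}:(0,1)\to\mathbb{R}$ is its inverse. The function $f$ is the quotient of the expected sample size $\eta(\alpha)$ of the sequential probability ratio test and the fixed sample size $(\Phi^{-1}(\alpha))^2$ when testing drift $1$ against drift $-1$ of a Brownian motion with both error probabilities bounded by $\alpha$. *)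

theory Defs
  imports "HOL-Probability.Probability" "HOL-Library.Landau_Symbols"
begin

definition Phi :: "real \<Rightarrow> real" where
  "Phi = cdf std_normal_distribution"

text \<open>\<^const>\<open>Phi\<close> maps the reals bijectively onto the open unit interval, so on that interval
  \<^const>\<open>inv\<close> yields the genuine inverse function (the quantile function); outside of it the value
  is arbitrary.\<close>

definition Phi_inv :: "real \<Rightarrow> real" where
  "Phi_inv = inv Phi"

definition eta :: "real \<Rightarrow> real" where
  "eta \<alpha> = (1 - 2 * \<alpha>) / 2 * ln ((1 - \<alpha>) / \<alpha>)"

text \<open>The paper's function \<open>f\<close> on the open interval from \<open>0\<close> to \<open>1/2\<close>: expected sample size of the
  sequential probability ratio test divided by the fixed sample size, for drift \<open>1\<close> against drift
  \<open>-1\<close> of a Brownian motion with error probabilities at most \<open>\<alpha>\<close>.\<close>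

definition sprt_ratio :: "real \<Rightarrow> real" where
  "sprt_ratio \<alpha> = eta \<alpha> / (Phi_inv \<alpha>)\<^sup>2"

end

theory Submission
  imports Defs "HOL-Real_Asymp.Real_Asymp"
begin

text \<open>Write \<open>\<alpha> = Phi (-z)\<close> and \<open>L = - ln \<alpha>\<close>. The Mills ratio bounds give
  \<open>L = z\<^sup>2 / 2 + ln z + O(1)\<close>, while \<open>eta \<alpha> = L / 2 + o(1)\<close>. Hence
  \<open>eta \<alpha> / z\<^sup>2 - 1 / 4 = (ln z + O(1)) / (2 * z\<^sup>2)\<close>, and since \<open>z\<^sup>2 \<sim> 2 * L\<close> and
  \<open>ln z \<sim> ln L / 2\<close>, this is asymptotically \<open>ln L / (8 * L)\<close>.\<close>

section \<open>Mills ratio bounds for the normal tail\<close>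

lemma emeasure_std_normal_atMost:
  "emeasure std_normal_distribution {..-z} = (\<integral>\<^sup>+t. ennreal (std_normal_density t) * indicator {z..} t \<partial>lborel)"
proof -
  have "emeasure std_normal_distribution {..-z}
      = (\<integral>\<^sup>+t. ennreal (std_normal_density t) * indicator {..-z} t \<partial>lborel)"
    by (simp add: emeasure_density)
  \<comment> \<open>The density is even, so reflecting \<open>t\<close> to \<open>-t\<close> moves
    the lower tail to a half-line \<open>{z..}\<close> of positive numbers, where division by
    \<open>t\<close> is harmless.\<close>
  also have "\<dots> = (\<integral>\<^sup>+t. ennreal (std_normal_density (-t)) * indicator {..-z} (-t) \<partial>lborel)"
    by (subst nn_integral_real_affine[where c = "-1" and t = 0]) auto
  also have "\<dots> = (\<integral>\<^sup>+t. ennreal (std_normal_density t) * indicator {z..} t \<partial>lborel)"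
    by (intro nn_integral_cong) (auto simp: std_normal_density_def indicator_def)
  finally show ?thesis .
qed

lemma std_normal_density_has_real_derivative [derivative_intros]:
  "(std_normal_density has_real_derivative - x * std_normal_density x) (at x)"
proof -
  have "((\<lambda>x. exp (- x\<^sup>2 / 2)) has_real_derivative - x * exp (- x\<^sup>2 / 2)) (at x)"
    by (auto intro!: derivative_eq_intros)
  from DERIV_cmult[OF this, of "1 / sqrt (2 * pi)"] show ?thesis
    unfolding std_normal_density_def[abs_def] by (simp add: mult_ac)
qed

text \<open>The weight \<open>1 + 1 / t\<^sup>2\<close> makes the tail integral exact; it lies between \<open>1\<close> and
  \<open>1 + 1 / z\<^sup>2\<close> on the domain of integration, which yields both Mills ratio bounds.\<close>

lemma nn_integral_std_normal_tail:
  fixes z :: real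
  assumes "z > 0"
  shows "(\<integral>\<^sup>+t. ennreal ((1 + 1 / t\<^sup>2) * std_normal_density t) * indicator {z..} t \<partial>lborel)
       = ennreal (std_normal_density z / z)"
proof -
  have "(\<integral>\<^sup>+t. ennreal ((1 + 1 / t\<^sup>2) * std_normal_density t) * indicator {z..} t \<partial>lborel)
     = ennreal (0 - (- (std_normal_density z / z)))"
  proof (rule nn_integral_FTC_atLeast)
    show "((\<lambda>t. - (std_normal_density t / t)) \<longlongrightarrow> 0) at_top"
      unfolding std_normal_density_def by real_asymp
    \<comment> \<open>The density has derivative \<open>- t\<close> times itself, so the quotient
      rule yields the density plus the density over \<open>t\<close> squared. This is the origin of
      the weight.\<close>
    show "((\<lambda>t. - (std_normal_density t / t)) has_real_derivative
        (1 + 1 / x\<^sup>2) * std_normal_density x) (at x)" if "z \<le> x" for x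
      using that assms by (auto intro!: derivative_eq_intros simp: field_simps power2_eq_square)
  qed (use assms in auto)
  thus ?thesis by simp
qed

lemma Phi_bounds:
  assumes "z > 0"
  shows "Phi (-z) \<le> std_normal_density z / z"
    and "std_normal_density z / z \<le> (1 + 1 / z\<^sup>2) * Phi (-z)"
proof -
  interpret prob_space std_normal_distribution by (rule prob_space_normal_density) simp
  let ?I = "\<lambda>g. \<integral>\<^sup>+t. ennreal (g t) * indicator {z..} t \<partial>lborel"
  have Phi: "ennreal (Phi (-z)) = ?I std_normal_density"
    by (simp add: Phi_def cdf_def emeasure_eq_measure[symmetric] emeasure_std_normal_atMost)
  have "ennreal (Phi (-z)) \<le> ?I (\<lambda>t. (1 + 1 / t\<^sup>2) * std_normal_density t)"
    unfolding Phi by (intro nn_integral_mono mult_right_mono ennreal_leI) (auto simp: algebra_simps)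
  also have "\<dots> = ennreal (std_normal_density z / z)"
    by (rule nn_integral_std_normal_tail[OF assms])
  finally show "Phi (-z) \<le> std_normal_density z / z"
    using assms by (simp add: ennreal_le_iff)
  have "ennreal (std_normal_density z / z) = ?I (\<lambda>t. (1 + 1 / t\<^sup>2) * std_normal_density t)"
    by (rule nn_integral_std_normal_tail[OF assms, symmetric])
  also have "\<dots> \<le> (\<integral>\<^sup>+t. ennreal (1 + 1 / z\<^sup>2) * (ennreal (std_normal_density t) * indicator {z..} t) \<partial>lborel)"
  proof (intro nn_integral_mono)
    fix t :: real
    show "ennreal ((1 + 1 / t\<^sup>2) * std_normal_density t) * indicator {z..} t
       \<le> ennreal (1 + 1 / z\<^sup>2) * (ennreal (std_normal_density t) * indicator {z..} t)"
    proof (cases "z \<le> t")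
      case True
      hence "1 / t\<^sup>2 \<le> 1 / z\<^sup>2" using assms by (intro divide_left_mono) (auto intro: power_mono)
      hence "ennreal ((1 + 1 / t\<^sup>2) * std_normal_density t)
          \<le> ennreal ((1 + 1 / z\<^sup>2) * std_normal_density t)"
        by (intro ennreal_leI mult_right_mono) auto
      also have "\<dots> = ennreal (1 + 1 / z\<^sup>2) * ennreal (std_normal_density t)"
        by (rule ennreal_mult) auto
      finally show ?thesis using True by simp
    qed auto
  qed
  also have "\<dots> = ennreal (1 + 1 / z\<^sup>2) * ?I std_normal_density"
    by (subst nn_integral_cmult) auto
  also have "\<dots> = ennreal ((1 + 1 / z\<^sup>2) * Phi (-z))"
    unfolding Phi[symmetric] by (subst ennreal_mult) (auto simp: Phi_def cdf_def)
  finally show "std_normal_density z / z \<le> (1 + 1 / z\<^sup>2) * Phi (-z)"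
    by (subst (asm) ennreal_le_iff) (auto simp: Phi_def cdf_def)
qed

section \<open>The distribution function and its inverse\<close>

lemma Phi_mono: "x \<le> y \<Longrightarrow> Phi x \<le> Phi y"
proof -
  interpret real_distribution std_normal_distribution
    by (rule real_dist_normal_dist)
  show "x \<le> y \<Longrightarrow> Phi x \<le> Phi y" unfolding Phi_def by (rule cdf_nondecreasing)
qed

text \<open>\<open>inv\<close> is a right inverse on the range, so it is enough to find some
  preimage of \<open>a\<close>. The intermediate value theorem supplies one: the normal law has no
  atoms, hence \<open>Phi\<close> is continuous, and its limits at the two ends are 0 and 1.\<close>

lemma Phi_Phi_inv:
  assumes "0 < a" "a < 1"
  shows "Phi (Phi_inv a) = a"
proof -
  interpret real_distribution std_normal_distribution
    by (rule real_dist_normal_dist)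
  have cont: "isCont Phi x" for x
  proof -
    have "emeasure std_normal_distribution {x} = 0"
      by (subst emeasure_density) (auto intro!: nn_integral_0_iff_AE[THEN iffD2] AE_I[where N = "{x}"])
    thus ?thesis unfolding Phi_def isCont_cdf by (simp add: measure_def)
  qed
  have "eventually (\<lambda>x. Phi x < a) at_bot" "eventually (\<lambda>x. a < Phi x) at_top"
    using cdf_lim_at_bot cdf_lim_at_top_prob assms unfolding Phi_def by (auto dest: order_tendstoD)
  then obtain x y where x: "Phi x < a" and y: "a < Phi y"
    using eventually_happens trivial_limit_at_bot_linorder trivial_limit_at_top_linorder by metis
  hence "x \<le> y" using Phi_mono[of y x] by linarith
  then obtain w where "Phi w = a" using IVT'[of Phi x a y] x y cont
    by (auto simp: continuous_at_imp_continuous_on)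
  thus ?thesis unfolding Phi_inv_def by (metis f_inv_into_f rangeI)
qed

text \<open>The lower Mills bound gives positivity far to the left, at a point \<open>-z\<close>
  with \<open>z\<close> positive and \<open>-z\<close> at most \<open>x\<close>; monotonicity
  carries it to \<open>x\<close>.\<close>

lemma Phi_pos: "Phi x > 0"
proof -
  define z where "z = max 1 (-x)"
  have "0 < (1 + 1 / z\<^sup>2) * Phi (-z)"
    by (rule less_le_trans[OF _ Phi_bounds(2)]) (auto simp: z_def normal_density_pos)
  hence "0 < Phi (-z)" by (auto simp: zero_less_mult_iff z_def Phi_def cdf_def)
  also have "Phi (-z) \<le> Phi x" by (rule Phi_mono) (auto simp: z_def)
  finally show ?thesis .
qed

text \<open>As \<open>Phi M\<close> is positive, every small enough \<open>a\<close> lies below it,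
  and then monotonicity of \<open>Phi\<close> forces \<open>Phi_inv a\<close> below
  \<open>M\<close>.\<close>

lemma Phi_inv_at_bot: "filterlim Phi_inv at_bot (at_right 0)"
  unfolding filterlim_at_bot
proof
  fix M
  have "eventually (\<lambda>a. a < min 1 (Phi M) \<and> 0 < a) (at_right 0)"
    using Phi_pos[of M] by (auto simp: eventually_at_right_less intro!: eventually_conj eventually_at_rightI[of 0 "min 1 (Phi M)"])
  thus "eventually (\<lambda>a. Phi_inv a \<le> M) (at_right 0)"
  proof eventually_elim
    case (elim a)
    hence "Phi (Phi_inv a) < Phi M" using Phi_Phi_inv[of a] by simp
    thus ?case using Phi_mono[of M "Phi_inv a"] by linarith
  qed
qed

section \<open>Logarithmic asymptotics of the tail and of the ratio\<close>

lemma neg_ln_Phi_bounds: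
  assumes "z \<ge> 1"
  shows "\<bar>- ln (Phi (-z)) - (z\<^sup>2 / 2 + ln z) - ln (sqrt (2 * pi))\<bar> \<le> ln 2"
proof -
  have eq: "ln (std_normal_density z / z) = - (z\<^sup>2 / 2 + ln z) - ln (sqrt (2 * pi))"
    using assms by (simp add: std_normal_density_def ln_div ln_mult)
  have pos: "std_normal_density z / z > 0" using assms by (simp add: normal_density_pos)
  have "ln (Phi (-z)) \<le> ln (std_normal_density z / z)"
    using Phi_bounds(1)[of z] Phi_pos[of "-z"] assms by (intro ln_mono) auto
  \<comment> \<open>From \<open>z = 1\<close> on, the Mills correction factor is at most 2; this is
    the source of the error \<open>ln 2\<close>.\<close>
  moreover have "std_normal_density z / z \<le> 2 * Phi (-z)"
  proof -
    have "1 / z\<^sup>2 \<le> 1" using assms by (simp add: field_simps)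
    hence "(1 + 1 / z\<^sup>2) * Phi (-z) \<le> 2 * Phi (-z)"
      using Phi_pos[of "-z"] by (intro mult_right_mono) auto
    thus ?thesis using Phi_bounds(2)[of z] assms by linarith
  qed
  hence "ln (std_normal_density z / z) \<le> ln 2 + ln (Phi (-z))"
    using pos Phi_pos[of "-z"] ln_mult[of 2 "Phi (-z)"]
      ln_mono[of "std_normal_density z / z" "2 * Phi (-z)"] by simp
  ultimately show ?thesis using eq ln_gt_zero[of 2] by (auto simp: abs_le_iff)
qed

text \<open>This discards the bounded remainders, first relative to \<open>z\<close> squared and
  later relative to \<open>ln z\<close>.\<close>

lemma bounded_over_at_top:
  fixes r g :: "'a \<Rightarrow> real"
  assumes "eventually (\<lambda>z. \<bar>r z\<bar> \<le> K) F" "filterlim g at_top F"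
  shows "((\<lambda>z. r z / g z) \<longlongrightarrow> 0) F"
proof (rule Lim_null_comparison)
  show "((\<lambda>z. K / g z) \<longlongrightarrow> 0) F"
    by (rule real_tendsto_divide_at_top[OF tendsto_const assms(2)])
  show "eventually (\<lambda>z. norm (r z / g z) \<le> K / g z) F"
    using assms(1) filterlim_at_top_dense[THEN iffD1, OF assms(2), rule_format, of 0]
    by eventually_elim (auto simp: divide_right_mono)
qed

text \<open>Taking the quantile \<open>-z\<close> as the free variable avoids any expansion of
  \<open>Phi_inv\<close>: only \<open>Phi\<close> has to be estimated.\<close>

lemma eta_over_square_limit:
  "((\<lambda>z. (eta (Phi (-z)) / z\<^sup>2 - 1 / 4) / (ln (- ln (Phi (-z))) / - ln (Phi (-z)))) \<longlongrightarrow> 1 / 8) at_top"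
proof -
  define q where "q = (\<lambda>z. Phi (-z))"
  define L where "L = (\<lambda>z. - ln (q z))"
  define r where "r = (\<lambda>z. L z - z\<^sup>2 / 2 - ln z)"
  define d where "d = (\<lambda>z. eta (q z) - L z / 2)"
  define K where "K = ln 2 + \<bar>ln (sqrt (2 * pi))\<bar>"
  have r: "eventually (\<lambda>z. \<bar>r z\<bar> \<le> K) at_top"
    using eventually_ge_at_top[of 1]
  proof eventually_elim
    case (elim z)
    thus ?case using neg_ln_Phi_bounds[of z] unfolding r_def K_def L_def q_def by linarith
  qed
  have qpos: "q z > 0" for z by (simp add: q_def Phi_pos)
  have Lz: "((\<lambda>z. L z / z\<^sup>2) \<longlongrightarrow> 1 / 2) at_top"
  proof (rule Lim_transform_eventually)
    have "((\<lambda>z. r z / z\<^sup>2) \<longlongrightarrow> 0) at_top"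
      by (rule bounded_over_at_top[OF r]) real_asymp
    moreover have "((\<lambda>z::real. 1 / 2 + ln z / z\<^sup>2) \<longlongrightarrow> 1 / 2) at_top" by real_asymp
    ultimately show "((\<lambda>z. (1 / 2 + ln z / z\<^sup>2) + r z / z\<^sup>2) \<longlongrightarrow> 1 / 2) at_top"
      by (auto intro: tendsto_eq_intros)
    show "eventually (\<lambda>z. (1 / 2 + ln z / z\<^sup>2) + r z / z\<^sup>2 = L z / z\<^sup>2) at_top"
      using eventually_gt_at_top[of 0] by eventually_elim (simp add: r_def field_simps)
  qed
  have Lpos: "eventually (\<lambda>z. L z / z\<^sup>2 > 0) at_top"
    by (rule order_tendstoD(1)[OF Lz]) simp
  have Linf: "filterlim L at_top at_top"
  proof (rule filterlim_cong[THEN iffD1, OF refl refl])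
    show "filterlim (\<lambda>z. L z / z\<^sup>2 * z\<^sup>2) at_top at_top"
      by (rule filterlim_tendsto_pos_mult_at_top[OF Lz]) (simp, real_asymp)
    show "eventually (\<lambda>z. L z / z\<^sup>2 * z\<^sup>2 = L z) at_top"
      using eventually_gt_at_top[of 0] by eventually_elim simp
  qed
  \<comment> \<open>Split \<open>ln (L z)\<close> into \<open>2 * ln z\<close> and the logarithm of
    \<open>L z\<close> over \<open>z\<close> squared. The latter converges to
    \<open>ln (1 / 2)\<close>, so it vanishes relative to \<open>ln z\<close>.\<close>
  have lnL: "((\<lambda>z. ln (L z) / ln z) \<longlongrightarrow> 2) at_top"
  proof (rule Lim_transform_eventually)
    have "((\<lambda>z. ln (L z / z\<^sup>2) / ln z) \<longlongrightarrow> 0) at_top"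
      by (rule real_tendsto_divide_at_top[OF tendsto_ln[OF Lz] ln_at_top]) simp
    thus "((\<lambda>z. 2 + ln (L z / z\<^sup>2) / ln z) \<longlongrightarrow> 2) at_top"
      by (auto intro: tendsto_eq_intros)
    show "eventually (\<lambda>z. 2 + ln (L z / z\<^sup>2) / ln z = ln (L z) / ln z) at_top"
      using eventually_gt_at_top[of 1] Lpos
    proof eventually_elim
      case (elim z)
      hence "L z > 0" by (simp add: zero_less_divide_iff)
      hence "ln (L z / z\<^sup>2) = ln (L z) - 2 * ln z" using elim by (simp add: ln_div ln_realpow)
      thus ?case using elim by (simp add: field_simps)
    qed
  qed
  have q0: "(q \<longlongrightarrow> 0) at_top"
  proof -
    have "((\<lambda>z. exp (- L z)) \<longlongrightarrow> 0) at_top"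
      by (rule filterlim_compose[OF exp_at_bot]) (simp add: Linf filterlim_uminus_at_bot)
    thus ?thesis using qpos by (simp add: L_def)
  qed
  have q0': "filterlim q (at_right 0) at_top"
    using q0 qpos by (intro tendsto_imp_filterlim_at_right) auto
  have d0: "(d \<longlongrightarrow> 0) at_top"
  proof -
    \<comment> \<open>The difference equals \<open>(1 - 2 * a) / 2 * ln (1 - a) + a * ln a\<close>,
      and both terms vanish at 0.\<close>
    have "((\<lambda>a::real. (1 - 2 * a) / 2 * ln ((1 - a) / a) - - ln a / 2) \<longlongrightarrow> 0) (at_right 0)"
      by real_asymp
    from filterlim_compose[OF this q0'] show ?thesis by (simp add: d_def eta_def L_def)
  qed
  have rd: "((\<lambda>z. (r z + 2 * d z) / ln z) \<longlongrightarrow> 0) at_top"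
  proof (rule bounded_over_at_top)
    have "eventually (\<lambda>z. \<bar>d z\<bar> < 1) at_top"
      using tendsto_rabs[OF d0] by (intro order_tendstoD(2)) auto
    with r show "eventually (\<lambda>z. \<bar>r z + 2 * d z\<bar> \<le> K + 2) at_top"
      by eventually_elim linarith
  qed (rule ln_at_top)
  \<comment> \<open>The target quotient is rewritten with numerator and \<open>ln (L z)\<close> both
    measured against \<open>ln z\<close>. The numerator tends to 1, the denominator to 2 and
    \<open>L z\<close> over \<open>z\<close> squared to 1/2; with the remaining factor 1/2 this
    gives 1/8.\<close>
  have "((\<lambda>z. (1 + (r z + 2 * d z) / ln z) / (ln (L z) / ln z) * (L z / z\<^sup>2) / 2)
      \<longlongrightarrow> (1 + 0) / 2 * (1 / 2) / 2) at_top"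
    by (rule tendsto_divide[OF tendsto_mult[OF tendsto_divide[OF tendsto_add[OF tendsto_const rd] lnL]
          Lz] tendsto_const]) auto
  hence "((\<lambda>z. (1 + (r z + 2 * d z) / ln z) / (ln (L z) / ln z) * (L z / z\<^sup>2) / 2) \<longlongrightarrow> 1 / 8) at_top"
    by simp
  moreover have "eventually (\<lambda>z. (1 + (r z + 2 * d z) / ln z) / (ln (L z) / ln z) * (L z / z\<^sup>2) / 2
     = (eta (q z) / z\<^sup>2 - 1 / 4) / (ln (L z) / L z)) at_top"
    \<comment> \<open>Both \<open>z\<close> and \<open>L z\<close> must exceed 1 so that
      \<open>ln z\<close> and \<open>ln (L z)\<close> are nonzero denominators.\<close>
    using eventually_gt_at_top[of 1] filterlim_at_top_dense[THEN iffD1, OF Linf, rule_format, of 1]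
  proof eventually_elim
    case (elim z)
    \<comment> \<open>Insert \<open>eta (q z) = L z / 2 + d z\<close> and the expansion of
      \<open>L z\<close>; the quadratic terms cancel.\<close>
    have "eta (q z) - z\<^sup>2 / 4 = (ln z + r z + 2 * d z) / 2" by (simp add: d_def r_def field_simps)
    moreover have "eta (q z) / z\<^sup>2 - 1 / 4 = (eta (q z) - z\<^sup>2 / 4) / z\<^sup>2"
      using elim by (simp add: diff_divide_distrib)
    ultimately have eq: "eta (q z) / z\<^sup>2 - 1 / 4 = (ln z + r z + 2 * d z) / (2 * z\<^sup>2)"
      by (metis divide_divide_eq_left)
    have "ln z > 0" "ln (L z) > 0" using elim by auto
    thus ?case unfolding eq using elim by (simp add: field_simps)
  qed
  ultimately show ?thesis unfolding L_def q_def by (rule Lim_transform_eventually)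
qed

theorem proposition3p6:
  shows "(\<lambda>\<alpha>. sprt_ratio \<alpha> - (1 / 4 - ln (- ln \<alpha>) / (8 * ln \<alpha>)))
           \<in> o[at_right 0](\<lambda>\<alpha>. ln (- ln \<alpha>) / ln \<alpha>)"
proof (rule smalloI_tendsto)
  let ?g = "\<lambda>\<alpha>::real. ln (- ln \<alpha>) / ln \<alpha>"
  show nz: "eventually (\<lambda>\<alpha>. ?g \<alpha> \<noteq> 0) (at_right 0)"
  proof -
    have "eventually (\<lambda>\<alpha>::real. ln (- ln \<alpha>) > 0 \<and> ln \<alpha> < 0) (at_right 0)"
      by (intro eventually_conj) real_asymp+
    thus ?thesis by eventually_elim auto
  qed
  have "filterlim (\<lambda>\<alpha>. - Phi_inv \<alpha>) at_top (at_right 0)"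
    using Phi_inv_at_bot by (simp add: filterlim_uminus_at_top)
  \<comment> \<open>The comparison function \<open>?g\<close> is the negative of the denominator in
    the limit just proved. Hence the deviation from 1/4 contributes -1/8 after division by
    \<open>?g\<close>, and the explicit second term contributes the compensating 1/8.\<close>
  from tendsto_diff[OF tendsto_const[of "1 / 8"] filterlim_compose[OF eta_over_square_limit this]]
  have "((\<lambda>\<alpha>. 1 / 8 - (eta (Phi (- (- Phi_inv \<alpha>))) / (- Phi_inv \<alpha>)\<^sup>2 - 1 / 4) /
          (ln (- ln (Phi (- (- Phi_inv \<alpha>)))) / - ln (Phi (- (- Phi_inv \<alpha>))))) \<longlongrightarrow> 0) (at_right 0)"
    unfolding diff_self .
  moreover have "eventually (\<lambda>\<alpha>. 1 / 8 - (eta (Phi (- (- Phi_inv \<alpha>))) / (- Phi_inv \<alpha>)\<^sup>2 - 1 / 4) /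
          (ln (- ln (Phi (- (- Phi_inv \<alpha>)))) / - ln (Phi (- (- Phi_inv \<alpha>))))
      = (sprt_ratio \<alpha> - (1 / 4 - ln (- ln \<alpha>) / (8 * ln \<alpha>))) / ?g \<alpha>) (at_right 0)"
    \<comment> \<open>Restricting to \<alpha> in (0,1) lets \<open>Phi\<close> undo
      \<open>Phi_inv\<close>; the square absorbs the sign of
      \<open>z = - Phi_inv \<alpha>\<close>.\<close>
    using nz eventually_at_right_real[of 0 1, OF zero_less_one]
  proof eventually_elim
    case (elim \<alpha>)
    hence "1 / 8 - (sprt_ratio \<alpha> - 1 / 4) / (ln (- ln \<alpha>) / - ln \<alpha>)
        = (sprt_ratio \<alpha> - (1 / 4 - ln (- ln \<alpha>) / (8 * ln \<alpha>))) / ?g \<alpha>"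
      by (simp add: field_simps)
    thus ?case using elim by (simp only: minus_minus power2_minus sprt_ratio_def Phi_Phi_inv greaterThanLessThan_iff)
  qed
  ultimately show "((\<lambda>\<alpha>. (sprt_ratio \<alpha> - (1 / 4 - ln (- ln \<alpha>) / (8 * ln \<alpha>))) / ?g \<alpha>) \<longlongrightarrow> 0) (at_right 0)"
    by (auto intro: Lim_transform_eventually)
qed

end
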